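(* Let $\Pi^{(1)},\dots,\Pi^{(I)}$ be i.i.d. exchangeable random partitions of $\mathbb{N}$ with EPPF $\mathfrak{q}$ and $\Pi^{(0)}$ an exchangeable random partition of $\mathbb{N}$ with EPPF $\mathfrak{q}_0$, independent of $(\Pi^{(1)},\dots,\Pi^{(I)})$. Let $n_1(t),\dots,n_I(t)$ be positive integers, $n(t)=\sum_{i=1}^In_i(t)$, and define $$K_{i,t}:=|\Pi^{(i)}_{n_i(t)}|,\quad K_t:=\sum_{i=1}^I|\Pi^{(i)}_{n_i(t)}|,\quad D_{i,t}:=|\Pi^{(0)}_{K_{i,t}}|,\quad D_t:=|\Pi^{(0)}_{K_t}|.$$ For every $n\ge1$ and $k=1,\dots,n$ let $q_n(k):=\mathbb{P}\{|\Pi^{(i)}_n|=k\}$ (the same for all $i=1,\dots,I$) and $q^{(0)}_n(k):=\mathbb{P}\{|\Pi^{(0)}_n|=k\}$. Then, for every $i=1,\dots,I$, $$\mathbb{P}\{D_{i,t}=k\}=\sum_{m=k}^{n_i(t)}q_{n_i(t)}(m)\,q^{(0)}_m(k),\qquad k=1,\dots,n_i(t),$$ and $$\mathbb{P}\{D_t=k\}=\sum_{m=\max(I,k)}^{n(t)}\Bigg(\sum_{\substack{m_1+\dots+m_I=m,\\1\le m_i\le n_i(t)}}\ \prod_{i=1}^Iq_{n_i(t)}(m_i)\Bigg)q^{(0)}_m(k),\qquad k=1,\dots,n(t).$$ Moreover, for every $r>0$, $$\mathbb{E}[D_{i,t}^r]=\sum_{m=1}^{n_i(t)}\mathbb{E}\big[|\Pi^{(0)}_m|^r\big]\,q_{n_i(t)}(m)$$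 and $$\mathbb{E}[D_t^r]=\sum_{\substack{m_1,\dots,m_I:\\1\le m_i\le n_i(t)}}\mathbb{E}\Big[\big|\Pi^{(0)}_{\sum_{i=1}^Im_i}\big|^r\Big]\prod_{i=1}^Iq_{n_i(t)}(m_i).$$
   Context: A random partition of $\mathbb{N}$ is a sequence $\Pi=(\Pi_n)_{n\ge1}$ with $\Pi_n$ a random partition of $\{1,\dots,n\}$, consistent under restriction; $|\Pi_n|$ denotes its number of blocks. It is exchangeable if the law of each $\Pi_n$ is invariant under permutations of $\{1,\dots,n\}$; then $\mathbb{P}\{\Pi_n=\pi_n\}=\mathfrak{q}(|\pi_{1,n}|,\dots,|\pi_{k,n}|)$ for every partition $\pi_n$ of $\{1,\dots,n\}$ with $k$ blocks $\pi_{1,n},\dots,\pi_{k,n}$, where $\mathfrak{q}$ is a symmetric function called the EPPF of $\Pi$. *)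

theory Defs
  imports "HOL-Probability.Probability" "HOL-Combinatorics.Permutations"
begin

definition partitions_upto :: "nat \<Rightarrow> nat set set set" where
  "partitions_upto n = {P. partition_on {1..n} P}"

text \<open>Sequences are indexed by all natural numbers for convenience: the entry at index 0 is
  forced to be the empty partition of the empty set and carries no information.\<close>

definition partition_seq_space :: "(nat \<Rightarrow> nat set set) measure" where
  "partition_seq_space = PiM UNIV (\<lambda>n. count_space (partitions_upto n))"

definition restrict_partition :: "nat \<Rightarrow> nat set set \<Rightarrow> nat set set" where
  "restrict_partition m P = (\<lambda>B. B \<inter> {1..m}) ` P - {{}}"

definition random_partition :: "'w measure \<Rightarrow> ('w \<Rightarrow> nat \<Rightarrow> nat set set) \<Rightarrow> bool" where
  "random_partition M X \<longleftrightarrow>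
     X \<in> measurable M partition_seq_space \<and>
     (\<forall>\<omega>\<in>space M. \<forall>n. \<forall>m\<le>n. X \<omega> m = restrict_partition m (X \<omega> n))"

definition exchangeable :: "'w measure \<Rightarrow> ('w \<Rightarrow> nat \<Rightarrow> nat set set) \<Rightarrow> bool" where
  "exchangeable M X \<longleftrightarrow>
     (\<forall>n\<ge>1. \<forall>\<sigma>. \<sigma> permutes {1..n} \<longrightarrow>
        distr M (count_space (partitions_upto n)) (\<lambda>\<omega>. (\<lambda>B. \<sigma> ` B) ` X \<omega> n) =
        distr M (count_space (partitions_upto n)) (\<lambda>\<omega>. X \<omega> n))"

text \<open>The argument of an EPPF is the list of block sizes, in an arbitrary order of the blocks;
  its values on the empty list and on lists containing 0 are irrelevant.\<close>

definition has_EPPF ::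
  "'w measure \<Rightarrow> ('w \<Rightarrow> nat \<Rightarrow> nat set set) \<Rightarrow> (nat list \<Rightarrow> real) \<Rightarrow> bool" where
  "has_EPPF M X q \<longleftrightarrow>
     (\<forall>xs ys. 0 \<notin> set xs \<longrightarrow> mset xs = mset ys \<longrightarrow> q xs = q ys) \<and>
     (\<forall>n\<ge>1. \<forall>bs. distinct bs \<longrightarrow> partition_on {1..n} (set bs) \<longrightarrow>
        measure M {\<omega> \<in> space M. X \<omega> n = set bs} = q (map card bs))"

text \<open>The library's \<open>indep_var\<close> requires both random variables to have the same value type.\<close>

definition indep_elements ::
  "'w measure \<Rightarrow> 'a measure \<Rightarrow> ('w \<Rightarrow> 'a) \<Rightarrow> 'b measure \<Rightarrow> ('w \<Rightarrow> 'b) \<Rightarrow> bool" where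
  "indep_elements M S Y T Z \<longleftrightarrow>
     Y \<in> measurable M S \<and> Z \<in> measurable M T \<and>
     prob_space.indep_set M (sets (vimage_algebra (space M) Y S)) (sets (vimage_algebra (space M) Z T))"

definition num_blocks :: "('w \<Rightarrow> nat \<Rightarrow> nat set set) \<Rightarrow> nat \<Rightarrow> 'w \<Rightarrow> nat" where
  "num_blocks X n \<omega> = card (X \<omega> n)"

definition num_blocks_prob ::
  "'w measure \<Rightarrow> ('w \<Rightarrow> nat \<Rightarrow> nat set set) \<Rightarrow> nat \<Rightarrow> nat \<Rightarrow> real" where
  "num_blocks_prob M X n k = measure M {\<omega> \<in> space M. num_blocks X n \<omega> = k}"

text \<open>Below, \<open>X 1, \<dots>, X I\<close> are the group-level partitions, \<open>X 0\<close> is the top-level one,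
  and \<open>n i t\<close> is the sample size of group \<open>i\<close> at \<open>t\<close>.\<close>

definition K_group ::
  "(nat \<Rightarrow> 'w \<Rightarrow> nat \<Rightarrow> nat set set) \<Rightarrow> (nat \<Rightarrow> 't \<Rightarrow> nat) \<Rightarrow> nat \<Rightarrow> 't \<Rightarrow> 'w \<Rightarrow> nat" where
  "K_group X n i t \<omega> = num_blocks (X i) (n i t) \<omega>"

definition K_total ::
  "(nat \<Rightarrow> 'w \<Rightarrow> nat \<Rightarrow> nat set set) \<Rightarrow> (nat \<Rightarrow> 't \<Rightarrow> nat) \<Rightarrow> nat \<Rightarrow> 't \<Rightarrow> 'w \<Rightarrow> nat" where
  "K_total X n I t \<omega> = (\<Sum>i=1..I. num_blocks (X i) (n i t) \<omega>)"

definition D_group ::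
  "(nat \<Rightarrow> 'w \<Rightarrow> nat \<Rightarrow> nat set set) \<Rightarrow> (nat \<Rightarrow> 't \<Rightarrow> nat) \<Rightarrow> nat \<Rightarrow> 't \<Rightarrow> 'w \<Rightarrow> nat" where
  "D_group X n i t \<omega> = num_blocks (X 0) (K_group X n i t \<omega>) \<omega>"

definition D_total ::
  "(nat \<Rightarrow> 'w \<Rightarrow> nat \<Rightarrow> nat set set) \<Rightarrow> (nat \<Rightarrow> 't \<Rightarrow> nat) \<Rightarrow> nat \<Rightarrow> 't \<Rightarrow> 'w \<Rightarrow> nat" where
  "D_total X n I t \<omega> = num_blocks (X 0) (K_total X n I t \<omega>) \<omega>"

end

theory Submission
  imports Defs
begin

text \<open>Condition on the (finitely many) values of the numbers of blocks in the groups. Given these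
  values, the argument at which the top-level partition is evaluated is deterministic, and
  independence factorises every term. Applied to indicators this gives the two distributions,
  applied to powers the two moment formulas.\<close>

section \<open>Bounds on the number of blocks\<close>

text \<open>Blocks are nonempty, so each one accounts for at least one element; being disjoint,
  their sizes add up to \<open>card A\<close>.\<close>

lemma partition_on_card_le:
  assumes "partition_on A P" "finite A"
  shows "card P \<le> card A"
proof -
  have P: "finite P" "\<And>B. B \<in> P \<Longrightarrow> finite B \<and> B \<noteq> {}"
    using assms finite_elements[OF assms(2,1)]
    by (auto simp: partition_on_def intro: finite_subset[OF Union_upper])
  have "card P = (\<Sum>B\<in>P. 1)" by simp
  also have "\<dots> \<le> (\<Sum>B\<in>P. card B)"
    by (intro sum_mono) (use P in \<open>auto simp: Suc_le_eq card_gt_0_iff\<close>)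
  also have "\<dots> = card (\<Union>P)"
    by (rule card_Union_disjoint[symmetric]) (use assms(1) P(2) in \<open>auto simp: partition_on_def\<close>)
  finally show ?thesis using assms by (simp add: partition_on_def)
qed

lemma random_partition_measurable:
  "random_partition M X \<Longrightarrow> X \<in> measurable M partition_seq_space"
  by (simp add: random_partition_def)

text \<open>The information sits in the measurability condition: a measurable map sends
  \<open>space M\<close> into the product space, whose \<open>n\<close>-th coordinates range over
  \<open>partitions_upto n\<close>.\<close>

lemma random_partition_in_partitions:
  assumes "random_partition M X" "\<omega> \<in> space M"
  shows "partition_on {1..n} (X \<omega> n)"
  using measurable_space[OF random_partition_measurable[OF assms(1)] assms(2)]
  by (auto simp: partition_seq_space_def space_PiM partitions_upto_def dest: PiE_mem[of _ _ _ n])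

lemma num_blocks_le:
  assumes "random_partition M X" "\<omega> \<in> space M"
  shows "num_blocks X n \<omega> \<le> n"
  using partition_on_card_le[OF random_partition_in_partitions[OF assms, of n]]
  by (simp add: num_blocks_def)

lemma num_blocks_ge_1:
  assumes "random_partition M X" "\<omega> \<in> space M" "n \<ge> 1"
  shows "num_blocks X n \<omega> \<ge> 1"
proof -
  note P = random_partition_in_partitions[OF assms(1,2), of n]
  then have "X \<omega> n \<noteq> {}" "finite (X \<omega> n)"
    using \<open>n \<ge> 1\<close> finite_elements[OF _ P] by (auto simp: partition_on_def)
  then show ?thesis by (simp add: num_blocks_def Suc_le_eq card_gt_0_iff)
qed

section \<open>Events and probabilities for the number of blocks\<close>

text \<open>Expresses a block-count event through a set of partition sequences, so that statements
  about the sequence as a random element (its law, its independence) apply to block counts.\<close>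

definition block_count_set :: "nat \<Rightarrow> nat \<Rightarrow> (nat \<Rightarrow> nat set set) set" where
  "block_count_set n k = {x \<in> space partition_seq_space. card (x n) = k}"

text \<open>Each coordinate carries the discrete sigma-algebra, so any function of a single
  coordinate is measurable.\<close>

lemma block_count_set_measurable: "block_count_set n k \<in> sets partition_seq_space"
proof -
  have "(\<lambda>x. card (x n)) \<in> measurable partition_seq_space (count_space UNIV)"
    unfolding partition_seq_space_def
    by (rule measurable_compose[OF measurable_component_singleton]) auto
  from measurable_sets[OF this, of "{k}"] show ?thesis
    by (simp add: block_count_set_def vimage_def Int_def conj_commute)
qed

lemma num_blocks_event:
  assumes "X \<in> measurable M partition_seq_space"
  shows "{\<omega> \<in> space M. num_blocks X n \<omega> = k} = X -` block_count_set n k \<inter> space M"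
  using measurable_space[OF assms] by (auto simp: block_count_set_def num_blocks_def)

text \<open>Shows that block-count probabilities depend on \<open>X\<close> only through its law;
  this is how equality in distribution of the groups is exploited.\<close>

lemma num_blocks_prob_distr:
  assumes "X \<in> measurable M partition_seq_space"
  shows "num_blocks_prob M X n k = measure (distr M partition_seq_space X) (block_count_set n k)"
  using assms
  by (simp add: num_blocks_prob_def num_blocks_event measure_distr block_count_set_measurable)

lemma num_blocks_event_sets:
  assumes "X \<in> measurable M partition_seq_space"
  shows "{\<omega> \<in> space M. num_blocks X n \<omega> = k} \<in> sets M"
  by (simp add: num_blocks_event[OF assms] measurable_sets[OF assms block_count_set_measurable])

text \<open>Serves to drop vanishing terms when the ranges of the sums over \<open>m\<close> are cut
  down to \<open>m \<ge> k\<close>.\<close>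

lemma num_blocks_prob_eq_0:
  assumes "random_partition M X" "n < k"
  shows "num_blocks_prob M X n k = 0"
proof -
  have "{\<omega> \<in> space M. num_blocks X n \<omega> = k} = {}"
    using num_blocks_le[OF assms(1), of _ n] assms(2) by fastforce
  then show ?thesis by (simp only: num_blocks_prob_def measure_empty)
qed

lemma (in prob_space) expectation_indicator_num_blocks:
  assumes "X \<in> measurable M partition_seq_space"
  shows "expectation (\<lambda>\<omega>. indicator {k} (num_blocks X n \<omega>) :: real) = num_blocks_prob M X n k"
proof -
  have "expectation (\<lambda>\<omega>. indicator {k} (num_blocks X n \<omega>) :: real) =
      expectation (indicator {\<omega> \<in> space M. num_blocks X n \<omega> = k})"
    by (intro Bochner_Integration.integral_cong) (auto simp: indicator_def)
  then show ?thesis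
    by (simp add: num_blocks_prob_def num_blocks_event_sets[OF assms])
qed

section \<open>Expectation at an independent random index\<close>

text \<open>On the event \<open>Z \<omega> = c\<close> the random index may be replaced by the
  constant \<open>c\<close>. Since \<open>Z\<close> and each \<open>Y c\<close> take finitely many
  values, everything is a finite combination of indicators, hence integrable for every
  \<open>h\<close>. Independence is applied for one \<open>c\<close> at a time, so the
  \<open>Y c\<close> may depend on each other arbitrarily.\<close>

lemma (in prob_space) expectation_at_independent_index:
  fixes Y :: "'c \<Rightarrow> 'a \<Rightarrow> 'b" and Z :: "'a \<Rightarrow> 'c" and h :: "'b \<Rightarrow> real"
  assumes C: "finite C" "\<And>\<omega>. \<omega> \<in> space M \<Longrightarrow> Z \<omega> \<in> C"
    and B: "\<And>c. c \<in> C \<Longrightarrow> finite (B c)"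
      "\<And>c \<omega>. c \<in> C \<Longrightarrow> \<omega> \<in> space M \<Longrightarrow> Y c \<omega> \<in> B c"
    and Y: "\<And>c b. c \<in> C \<Longrightarrow> {\<omega> \<in> space M. Y c \<omega> = b} \<in> events"
    and Z: "\<And>c. c \<in> C \<Longrightarrow> {\<omega> \<in> space M. Z \<omega> = c} \<in> events"
    and indep: "\<And>c b. c \<in> C \<Longrightarrow>
      prob ({\<omega> \<in> space M. Y c \<omega> = b} \<inter> {\<omega> \<in> space M. Z \<omega> = c}) =
      prob {\<omega> \<in> space M. Y c \<omega> = b} * prob {\<omega> \<in> space M. Z \<omega> = c}"
  shows "expectation (\<lambda>\<omega>. h (Y (Z \<omega>) \<omega>)) =
    (\<Sum>c\<in>C. expectation (\<lambda>\<omega>. h (Y c \<omega>)) * prob {\<omega> \<in> space M. Z \<omega> = c})"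
proof -
  define EY where "EY c b = {\<omega> \<in> space M. Y c \<omega> = b}" for c b
  define EZ where "EZ c = {\<omega> \<in> space M. Z \<omega> = c}" for c
  note [measurable] = Y[folded EY_def] Z[folded EZ_def]
  have expand: "h (Y c \<omega>) = (\<Sum>b\<in>B c. h b * indicator (EY c b) \<omega>)"
    if "c \<in> C" "\<omega> \<in> space M" for c \<omega>
  proof -
    have "(\<Sum>b\<in>B c. h b * indicator (EY c b) \<omega>) = (\<Sum>b\<in>B c. if Y c \<omega> = b then h b else 0)"
      by (intro sum.cong) (auto simp: EY_def that)
    then show ?thesis using B that by simp
  qed
  have "expectation (\<lambda>\<omega>. h (Y (Z \<omega>) \<omega>)) =
      expectation (\<lambda>\<omega>. \<Sum>c\<in>C. \<Sum>b\<in>B c. h b * indicator (EY c b \<inter> EZ c) \<omega>)"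
  proof (intro Bochner_Integration.integral_cong refl)
    fix \<omega> assume \<omega>: "\<omega> \<in> space M"
    \<comment> \<open>The indicator of the intersection is a product; for fixed \<open>c\<close> the
      factor from \<open>EZ c\<close> is constant in \<open>b\<close>, and the rest sums to
      \<open>h (Y c \<omega>)\<close>. Only \<open>c = Z \<omega>\<close> survives the outer
      sum.\<close>
    have "(\<Sum>c\<in>C. \<Sum>b\<in>B c. h b * indicator (EY c b \<inter> EZ c) \<omega>) =
        (\<Sum>c\<in>C. if Z \<omega> = c then h (Y c \<omega>) else 0)"
      by (intro sum.cong refl) (auto simp: expand[OF _ \<omega>] indicator_inter_arith EZ_def \<omega>)
    then show "h (Y (Z \<omega>) \<omega>) = (\<Sum>c\<in>C. \<Sum>b\<in>B c. h b * indicator (EY c b \<inter> EZ c) \<omega>)"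
      using C \<omega> by simp
  qed
  also have "\<dots> = (\<Sum>c\<in>C. \<Sum>b\<in>B c. h b * prob (EY c b \<inter> EZ c))"
  proof -
    have int: "integrable M (\<lambda>\<omega>. h b * indicator (EY c b \<inter> EZ c) \<omega>)" if "c \<in> C" for c b
      using that by (intro integrable_mult_right integrable_real_indicator)
        (auto simp: less_top[symmetric])
    have inner: "expectation (\<lambda>\<omega>. \<Sum>b\<in>B c. h b * indicator (EY c b \<inter> EZ c) \<omega>) =
        (\<Sum>b\<in>B c. h b * prob (EY c b \<inter> EZ c))" if "c \<in> C" for c
      using that
      by (subst Bochner_Integration.integral_sum[OF int[OF that]]) simp
    show ?thesis
      by (subst Bochner_Integration.integral_sum) (auto simp: inner intro!: int)
  qed
  \<comment> \<open>Independence enters here: each joint probability splits, and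
    \<open>prob (EZ c)\<close> leaves the sum over \<open>b\<close>.\<close>
  also have "\<dots> = (\<Sum>c\<in>C. (\<Sum>b\<in>B c. h b * prob (EY c b)) * prob (EZ c))"
    by (intro sum.cong refl) (simp add: indep[folded EY_def EZ_def] sum_distrib_right mult.assoc)
  \<comment> \<open>For fixed \<open>c\<close> the indicator expansion is read backwards to recover
    the expectation.\<close>
  also have "\<dots> = (\<Sum>c\<in>C. expectation (\<lambda>\<omega>. h (Y c \<omega>)) * prob (EZ c))"
  proof (intro sum.cong refl arg_cong2[where f = "(*)"])
    fix c assume c: "c \<in> C"
    have "expectation (\<lambda>\<omega>. h (Y c \<omega>)) = expectation (\<lambda>\<omega>. \<Sum>b\<in>B c. h b * indicator (EY c b) \<omega>)"
      by (intro Bochner_Integration.integral_cong) (auto simp: expand c)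
    also have "\<dots> = (\<Sum>b\<in>B c. h b * prob (EY c b))"
    proof -
      have "integrable M (\<lambda>\<omega>. h b * indicator (EY c b) \<omega>)" for b
        using c by (intro integrable_mult_right integrable_real_indicator)
          (auto simp: less_top[symmetric])
      then show ?thesis
        using c by (subst Bochner_Integration.integral_sum) simp_all
    qed
    finally show "(\<Sum>b\<in>B c. h b * prob (EY c b)) = expectation (\<lambda>\<omega>. h (Y c \<omega>))" by simp
  qed
  finally show ?thesis by (simp add: EZ_def)
qed

section \<open>Laws and moments of \<open>D_group\<close> and \<open>D_total\<close>\<close>

theorem proposition6:
  fixes M :: "'w measure"
    and X :: "nat \<Rightarrow> 'w \<Rightarrow> nat \<Rightarrow> nat set set"
    and I :: nat
    and n :: "nat \<Rightarrow> 't \<Rightarrow> nat"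
    and t :: 't
    and \<qq> \<qq>\<^sub>0 :: "nat list \<Rightarrow> real"
  assumes "prob_space M"
    and "I \<ge> 1"
    and "\<And>i. i \<in> {0..I} \<Longrightarrow> random_partition M (X i)"
    and "\<And>i. i \<in> {0..I} \<Longrightarrow> exchangeable M (X i)"
    and "\<And>i. i \<in> {1..I} \<Longrightarrow> has_EPPF M (X i) \<qq>"
    and "has_EPPF M (X 0) \<qq>\<^sub>0"
    and "prob_space.indep_vars M (\<lambda>_. partition_seq_space) X {1..I}"
    and "\<And>i j. i \<in> {1..I} \<Longrightarrow> j \<in> {1..I} \<Longrightarrow>
           distr M partition_seq_space (X i) = distr M partition_seq_space (X j)"
    and "indep_elements M partition_seq_space (X 0)
           (PiM {1..I} (\<lambda>_. partition_seq_space)) (\<lambda>\<omega>. \<lambda>i\<in>{1..I}. X i \<omega>)"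
    and "\<And>i. i \<in> {1..I} \<Longrightarrow> n i t \<ge> 1"
  shows "let q = num_blocks_prob M (X 1); q\<^sub>0 = num_blocks_prob M (X 0) in
    (\<forall>i\<in>{1..I}. \<forall>N\<ge>1. \<forall>k\<in>{1..N}. num_blocks_prob M (X i) N k = q N k) \<and>
    (\<forall>i\<in>{1..I}. \<forall>k\<in>{1..n i t}.
       measure M {\<omega> \<in> space M. D_group X n i t \<omega> = k} =
       (\<Sum>m=k..n i t. q (n i t) m * q\<^sub>0 m k)) \<and>
    (\<forall>k\<in>{1..(\<Sum>i=1..I. n i t)}.
       measure M {\<omega> \<in> space M. D_total X n I t \<omega> = k} =
       (\<Sum>m=max I k..(\<Sum>i=1..I. n i t).
          (\<Sum>ms | ms \<in> (\<Pi>\<^sub>E i\<in>{1..I}. {1..n i t}) \<and> (\<Sum>i=1..I. ms i) = m.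
             \<Prod>i=1..I. q (n i t) (ms i)) * q\<^sub>0 m k)) \<and>
    (\<forall>r::real. r > 0 \<longrightarrow>
       (\<forall>i\<in>{1..I}.
          prob_space.expectation M (\<lambda>\<omega>. real (D_group X n i t \<omega>) powr r) =
          (\<Sum>m=1..n i t.
             prob_space.expectation M (\<lambda>\<omega>. real (num_blocks (X 0) m \<omega>) powr r) * q (n i t) m)) \<and>
       prob_space.expectation M (\<lambda>\<omega>. real (D_total X n I t \<omega>) powr r) =
       (\<Sum>ms\<in>(\<Pi>\<^sub>E i\<in>{1..I}. {1..n i t}).
          prob_space.expectation M (\<lambda>\<omega>. real (num_blocks (X 0) (\<Sum>i=1..I. ms i) \<omega>) powr r) *
          (\<Prod>i=1..I. q (n i t) (ms i))))"
proof -
  interpret prob_space M by fact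
  let ?J = "{1..I}"
  let ?S = "partition_seq_space"
  let ?T = "PiM ?J (\<lambda>_. ?S)"
  let ?C = "\<Pi>\<^sub>E i\<in>?J. {1..n i t}"
  define q where "q = num_blocks_prob M (X 1)"
  define q\<^sub>0 where "q\<^sub>0 = num_blocks_prob M (X 0)"
  \<comment> \<open>\<open>W\<close> bundles the groups into one random element, the form in which
    their independence from \<open>X 0\<close> is given. \<open>Z\<close> is the vector of group
    block counts; restricting it to \<open>?J\<close> makes it an element of
    \<open>?C\<close>.\<close>
  define W where "W \<omega> = (\<lambda>i\<in>?J. X i \<omega>)" for \<omega>
  define Z where "Z \<omega> = (\<lambda>i\<in>?J. num_blocks (X i) (n i t) \<omega>)" for \<omega>
  have rp: "random_partition M (X i)" if "i \<in> {0..I}" for i by (fact assms(3)[OF that])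
  have X0: "random_partition M (X 0)" by (rule rp) simp
  have rpJ: "random_partition M (X i)" if "i \<in> ?J" for i using rp that by auto
  have meas: "X i \<in> measurable M ?S" if "i \<in> {0..I}" for i
    by (rule random_partition_measurable[OF rp[OF that]])
  have meas0: "X 0 \<in> measurable M ?S" by (rule meas) simp
  have measJ: "X i \<in> measurable M ?S" if "i \<in> ?J" for i using meas that by auto
  \<comment> \<open>\<open>q\<close> is read off at index 1, which lies in \<open>?J\<close> because
    \<open>I \<ge> 1\<close>; equality in law carries it over to every group.\<close>
  have same: "num_blocks_prob M (X i) N k = q N k" if "i \<in> ?J" for i N k
  proof -
    have "1 \<in> ?J" using \<open>I \<ge> 1\<close> by simp
    then show ?thesis
      by (simp only: q_def num_blocks_prob_distr measJ that assms(8)[OF that])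
  qed

  \<comment> \<open>Independence and the joint law of the group block counts\<close>
  have W: "W \<in> measurable M ?T"
    and ind: "indep_set (sets (vimage_algebra (space M) (X 0) ?S)) (sets (vimage_algebra (space M) W ?T))"
    using assms(9) by (simp_all add: indep_elements_def W_def[abs_def])
  \<comment> \<open>Both events are preimages of measurable sets, under \<open>X 0\<close> and
    \<open>W\<close> respectively, so they belong to the two independent sigma-algebras.\<close>
  have factor: "prob ({\<omega> \<in> space M. num_blocks (X 0) m \<omega> = b} \<inter> (W -` A \<inter> space M)) =
      prob {\<omega> \<in> space M. num_blocks (X 0) m \<omega> = b} * prob (W -` A \<inter> space M)"
    if "A \<in> sets ?T" for m b A
    unfolding num_blocks_event[OF meas0]
    by (rule indep_setD[OF ind])
      (rule in_vimage_algebra, rule block_count_set_measurable, rule in_vimage_algebra, rule that)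

  \<comment> \<open>The sets whose preimages under \<open>W\<close> are the conditioning events:
    \<open>AG\<close> fixes the block count of one group, \<open>AT\<close> is the rectangle fixing
    those of all groups.\<close>
  define AG where "AG i m = {x \<in> space ?T. x i \<in> block_count_set (n i t) m}" for i m
  define AT where "AT ms = (\<Pi>\<^sub>E i\<in>?J. block_count_set (n i t) (ms i))" for ms
  have AG: "AG i m \<in> sets ?T" if "i \<in> ?J" for i m
    unfolding AG_def
    using measurable_sets[OF measurable_component_singleton[OF that] block_count_set_measurable]
    by (simp add: vimage_def Int_def conj_commute)
  have AT: "AT ms \<in> sets ?T" for ms
    unfolding AT_def by (intro sets_PiM_I_finite) (auto simp: block_count_set_measurable)
  have AG_event: "{\<omega> \<in> space M. num_blocks (X i) (n i t) \<omega> = m} = W -` AG i m \<inter> space M"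
    if "i \<in> ?J" for i m
    unfolding num_blocks_event[OF measJ[OF that]]
    using measurable_space[OF W] that by (auto simp: AG_def W_def)
  \<comment> \<open>Here \<open>I \<ge> 1\<close> matters: over an empty index set the intersection
    would be \<open>UNIV\<close> instead of \<open>space M\<close>.\<close>
  have AT_inter: "W -` AT ms \<inter> space M =
      (\<Inter>i\<in>?J. X i -` block_count_set (n i t) (ms i) \<inter> space M)" for ms
    using \<open>I \<ge> 1\<close> by (fastforce simp: AT_def W_def PiE_iff)
  have AT_event: "{\<omega> \<in> space M. Z \<omega> = ms} = W -` AT ms \<inter> space M" if "ms \<in> ?C" for ms
  proof -
    \<comment> \<open>Outside \<open>?J\<close> both functions are \<open>undefined\<close>, so
      comparing them on \<open>?J\<close> suffices.\<close>
    have "Z \<omega> = ms \<longleftrightarrow> (\<forall>i\<in>?J. num_blocks (X i) (n i t) \<omega> = ms i)" for \<omega>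
      using that by (auto simp: Z_def fun_eq_iff PiE_iff extensional_def)
    then have "{\<omega> \<in> space M. Z \<omega> = ms} =
        (\<Inter>i\<in>?J. {\<omega> \<in> space M. num_blocks (X i) (n i t) \<omega> = ms i})"
      using \<open>I \<ge> 1\<close> by fastforce
    also have "\<dots> = W -` AT ms \<inter> space M"
      unfolding AT_inter by (intro INF_cong refl num_blocks_event measJ)
    finally show ?thesis .
  qed
  have prob_Z: "prob {\<omega> \<in> space M. Z \<omega> = ms} = (\<Prod>i=1..I. q (n i t) (ms i))"
    if "ms \<in> ?C" for ms
  proof -
    \<comment> \<open>Mutual independence of the groups turns the probability of the intersection
      into a product; equality in law then identifies each factor.\<close>
    have "prob {\<omega> \<in> space M. Z \<omega> = ms} =
        (\<Prod>i\<in>?J. prob (X i -` block_count_set (n i t) (ms i) \<inter> space M))"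
      unfolding AT_event[OF that] AT_inter
      by (rule indep_varsD[OF assms(7)]) (use \<open>I \<ge> 1\<close> in \<open>auto simp: block_count_set_measurable\<close>)
    also have "\<dots> = (\<Prod>i=1..I. q (n i t) (ms i))"
    proof (intro prod.cong refl)
      fix i assume "i \<in> ?J"
      then show "prob (X i -` block_count_set (n i t) (ms i) \<inter> space M) = q (n i t) (ms i)"
        by (simp add: same[symmetric] num_blocks_prob_def num_blocks_event[OF measJ])
    qed
    finally show ?thesis .
  qed

  \<comment> \<open>Expectations of functions of \<open>D_group\<close> and
    \<open>D_total\<close>\<close>
  have group: "expectation (\<lambda>\<omega>. h (D_group X n i t \<omega>)) =
      (\<Sum>m=1..n i t. expectation (\<lambda>\<omega>. h (num_blocks (X 0) m \<omega>)) * q (n i t) m)"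
    if i: "i \<in> ?J" for i and h :: "nat \<Rightarrow> real"
  proof -
    have "expectation (\<lambda>\<omega>. h (D_group X n i t \<omega>)) =
      (\<Sum>m=1..n i t. expectation (\<lambda>\<omega>. h (num_blocks (X 0) m \<omega>)) *
         prob {\<omega> \<in> space M. num_blocks (X i) (n i t) \<omega> = m})"
      unfolding D_group_def K_group_def
    \<comment> \<open>The index is the block count of group \<open>i\<close>, which lies in
      \<open>{1..n i t}\<close> because \<open>n i t \<ge> 1\<close>; the family is the block count
      of \<open>X 0\<close> at level \<open>m\<close>, which is at most \<open>m\<close>.\<close>
    proof (rule expectation_at_independent_index[where B = "\<lambda>m. {..m}"])
      fix m b
      show "prob ({\<omega> \<in> space M. num_blocks (X 0) m \<omega> = b} \<inter>
             {\<omega> \<in> space M. num_blocks (X i) (n i t) \<omega> = m}) =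
           prob {\<omega> \<in> space M. num_blocks (X 0) m \<omega> = b} *
           prob {\<omega> \<in> space M. num_blocks (X i) (n i t) \<omega> = m}"
        unfolding AG_event[OF i] by (rule factor[OF AG[OF i]])
    next
      fix \<omega> assume "\<omega> \<in> space M"
      then show "num_blocks (X i) (n i t) \<omega> \<in> {1..n i t}"
        using num_blocks_le[OF rpJ[OF i]] num_blocks_ge_1[OF rpJ[OF i] _ assms(10)[OF i]] by simp
    qed (simp_all add: num_blocks_le[OF X0] num_blocks_event_sets[OF measJ[OF i]]
          num_blocks_event_sets[OF meas0])
    then show ?thesis by (simp add: same[OF i, symmetric] num_blocks_prob_def)
  qed
  have total: "expectation (\<lambda>\<omega>. h (D_total X n I t \<omega>)) =
      (\<Sum>ms\<in>?C. expectation (\<lambda>\<omega>. h (num_blocks (X 0) (\<Sum>i=1..I. ms i) \<omega>)) *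
         (\<Prod>i=1..I. q (n i t) (ms i)))" for h :: "nat \<Rightarrow> real"
  proof -
    have "expectation (\<lambda>\<omega>. h (D_total X n I t \<omega>)) =
      expectation (\<lambda>\<omega>. h (num_blocks (X 0) (\<Sum>i=1..I. Z \<omega> i) \<omega>))"
      by (simp add: D_total_def K_total_def Z_def)
    \<comment> \<open>The index is the whole vector \<open>Z\<close> and not only the sum of its
      entries: the probabilities of its values are the products in \<open>prob_Z\<close>, and the
      sum runs over \<open>?C\<close> as desired.\<close>
    also have "\<dots> = (\<Sum>ms\<in>?C. expectation (\<lambda>\<omega>. h (num_blocks (X 0) (\<Sum>i=1..I. ms i) \<omega>)) *
         prob {\<omega> \<in> space M. Z \<omega> = ms})"
    proof (rule expectation_at_independent_index[where B = "\<lambda>ms. {..(\<Sum>i=1..I. ms i)}"])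
      fix \<omega> assume "\<omega> \<in> space M"
      then show "Z \<omega> \<in> ?C"
        using num_blocks_le[OF rpJ] num_blocks_ge_1[OF rpJ] assms(10) by (auto simp: Z_def)
    next
      fix ms b assume ms: "ms \<in> ?C"
      show "prob ({\<omega> \<in> space M. num_blocks (X 0) (\<Sum>i=1..I. ms i) \<omega> = b} \<inter>
             {\<omega> \<in> space M. Z \<omega> = ms}) =
           prob {\<omega> \<in> space M. num_blocks (X 0) (\<Sum>i=1..I. ms i) \<omega> = b} *
           prob {\<omega> \<in> space M. Z \<omega> = ms}"
        unfolding AT_event[OF ms] by (rule factor[OF AT])
    next
      fix ms assume ms: "ms \<in> ?C"
      show "{\<omega> \<in> space M. Z \<omega> = ms} \<in> events"
        unfolding AT_event[OF ms] by (rule measurable_sets[OF W AT])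
    qed (simp_all add: finite_PiE num_blocks_le[OF X0] num_blocks_event_sets[OF meas0])
    also have "\<dots> = (\<Sum>ms\<in>?C. expectation (\<lambda>\<omega>. h (num_blocks (X 0) (\<Sum>i=1..I. ms i) \<omega>)) *
         (\<Prod>i=1..I. q (n i t) (ms i)))"
      by (intro sum.cong refl) (simp only: prob_Z)
    finally show ?thesis .
  qed

  \<comment> \<open>The distributions, from indicator functions\<close>
  have ind0: "expectation (\<lambda>\<omega>. indicator {k} (num_blocks (X 0) m \<omega>) :: real) = q\<^sub>0 m k" for m k
    unfolding q\<^sub>0_def by (rule expectation_indicator_num_blocks[OF meas0])
  have q0_0: "q\<^sub>0 m k = 0" if "m < k" for m k
    unfolding q\<^sub>0_def by (rule num_blocks_prob_eq_0[OF X0 that])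
  \<comment> \<open>This holds for arbitrary \<open>D\<close>: should the event fail to be
    measurable, the integral and the measure both take their default value 0.\<close>
  have prob_eq: "prob {\<omega> \<in> space M. D \<omega> = k} = expectation (\<lambda>\<omega>. indicator {k} (D \<omega>))"
    for D :: "'w \<Rightarrow> nat" and k
  proof -
    have "expectation (\<lambda>\<omega>. indicator {k} (D \<omega>) :: real) =
        expectation (indicator {\<omega> \<in> space M. D \<omega> = k})"
      by (intro Bochner_Integration.integral_cong) (auto simp: indicator_def)
    also have "\<dots> = prob {\<omega> \<in> space M. D \<omega> = k}"
      by (simp add: Int_absorb2)
    finally show ?thesis by simp
  qed

  have group_law: "prob {\<omega> \<in> space M. D_group X n i t \<omega> = k} =
      (\<Sum>m=k..n i t. q (n i t) m * q\<^sub>0 m k)" if "i \<in> ?J" "k \<ge> 1" for i k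
  proof -
    have "prob {\<omega> \<in> space M. D_group X n i t \<omega> = k} = (\<Sum>m=1..n i t. q\<^sub>0 m k * q (n i t) m)"
      unfolding prob_eq by (simp only: group[OF that(1)] ind0)
    \<comment> \<open>A partition of \<open>m < k\<close> elements cannot have \<open>k\<close>
      blocks, so these terms vanish; \<open>k \<ge> 1\<close> keeps the new range inside the old
      one.\<close>
    also have "\<dots> = (\<Sum>m=k..n i t. q\<^sub>0 m k * q (n i t) m)"
      by (rule sum.mono_neutral_right) (use that q0_0 in auto)
    finally show ?thesis by (simp add: mult.commute)
  qed
  have total_law: "prob {\<omega> \<in> space M. D_total X n I t \<omega> = k} =
      (\<Sum>m=max I k..(\<Sum>i=1..I. n i t).
         (\<Sum>ms | ms \<in> ?C \<and> (\<Sum>i=1..I. ms i) = m. \<Prod>i=1..I. q (n i t) (ms i)) * q\<^sub>0 m k)" for k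
  proof -
    let ?P = "\<lambda>ms. \<Prod>i=1..I. q (n i t) (ms i)"
    let ?s = "\<lambda>ms. \<Sum>i=1..I. ms i :: nat"
    \<comment> \<open>Each of the \<open>I\<close> entries is at least 1, which gives the lower
      bound \<open>I\<close> on the sum.\<close>
    have s: "?s ms \<in> {I..(\<Sum>i=1..I. n i t)}" if "ms \<in> ?C" for ms
    proof -
      have le: "1 \<le> ms i" "ms i \<le> n i t" if "i \<in> ?J" for i
        using PiE_mem[OF \<open>ms \<in> ?C\<close> that] by auto
      have "(\<Sum>i=1..I. 1) \<le> ?s ms" by (intro sum_mono le)
      moreover have "?s ms \<le> (\<Sum>i=1..I. n i t)" by (intro sum_mono le)
      ultimately show ?thesis by simp
    qed
    have "prob {\<omega> \<in> space M. D_total X n I t \<omega> = k} = (\<Sum>ms\<in>?C. q\<^sub>0 (?s ms) k * ?P ms)"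
      unfolding prob_eq by (simp only: total ind0)
    \<comment> \<open>The vectors are sorted by their sum \<open>m\<close>. On each fibre the factor
      \<open>q\<^sub>0 (?s ms) k\<close> is constant and can be pulled out; the terms with
      \<open>m < k\<close> then vanish, which yields the lower limit \<open>max I k\<close>.\<close>
    also have "\<dots> = (\<Sum>m\<in>{I..(\<Sum>i=1..I. n i t)}. \<Sum>ms\<in>{ms \<in> ?C. ?s ms = m}. q\<^sub>0 (?s ms) k * ?P ms)"
      by (rule sum.group[symmetric]) (use s in \<open>auto intro!: finite_PiE\<close>)
    also have "\<dots> = (\<Sum>m\<in>{I..(\<Sum>i=1..I. n i t)}. (\<Sum>ms | ms \<in> ?C \<and> ?s ms = m. ?P ms) * q\<^sub>0 m k)"
      by (intro sum.cong refl) (simp add: sum_distrib_left mult.commute)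
    also have "\<dots> = (\<Sum>m=max I k..(\<Sum>i=1..I. n i t). (\<Sum>ms | ms \<in> ?C \<and> ?s ms = m. ?P ms) * q\<^sub>0 m k)"
      by (rule sum.mono_neutral_right) (use q0_0 in auto)
    finally show ?thesis .
  qed
  show ?thesis
    unfolding Let_def q_def[symmetric] q\<^sub>0_def[symmetric]
  proof (intro conjI ballI allI impI)
    \<comment> \<open>The moments are the case where \<open>h\<close> is the power function
      \<open>\<lambda>d. real d powr r\<close>.\<close>
    fix r :: real
    show "expectation (\<lambda>\<omega>. real (D_total X n I t \<omega>) powr r) =
       (\<Sum>ms\<in>?C. expectation (\<lambda>\<omega>. real (num_blocks (X 0) (\<Sum>i=1..I. ms i) \<omega>) powr r) *
          (\<Prod>i=1..I. q (n i t) (ms i)))"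
      by (rule total)
    fix i assume "i \<in> ?J"
    then show "expectation (\<lambda>\<omega>. real (D_group X n i t \<omega>) powr r) =
       (\<Sum>m=1..n i t. expectation (\<lambda>\<omega>. real (num_blocks (X 0) m \<omega>) powr r) * q (n i t) m)"
      by (rule group)
  qed (simp_all only: same group_law total_law atLeastAtMost_iff)
qed

end
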